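(* Let $M\subset G$ be the Cartan model of the symmetric space $G/K$ defined by $\sigma$, let $X\in\mathbb{K}^{n\times n}$ be a nonzero matrix and put $\widehat{X}=X^*+\sigma(X)$. A point $A\in M$ is a critical point of $h_X^M$ if and only if $$\widehat{X}=A\,\sigma(\widehat{X})\,A.$$
   Context: Let $\mathbb{K}$ be one of $\mathbb{R}$, $\mathbb{C}$, $\mathbb{H}$ (quaternions). For a matrix $A\in\mathbb{K}^{n\times n}$, $A^*$ denotes its conjugate transpose. $G$ is the identity component of the compact Lie group $O(n,\mathbb{K})=\{A\in\mathbb{K}^{n\times n}: AA^*=I\}$, i.e. $G=SO(n)$, $U(n)$ or $Sp(n)$. $\sigma\colon G\to G$ is an involutive automorphism which is the restriction of an involutive automorphism $\sigma\colon\mathbb{K}^{n\times n}\to\mathbb{K}^{n\times n}$ of unital (real) algebras satisfying $\sigma(Y^* )=\sigma(Y)^*$ for all $Y\in\mathbb{K}^{n\times n}$. $K=\{B\in G:\sigma(B)=B\}$ is the fixed point subgroup. The Cartan model of $G/K$ is the submanifold $M=\{B\sigma(B)^{-1}: B\in G\}\subset G$, i.e. the image of $G/K\to G$, $[B]\mapsto B\sigma(B)^{-1}$; it is the connected component of the identity of $N=\{B\in G:\sigma(B)=B^{-1}\}$. For $X\in\mathbb{K}^{n\times n}$ the height function is $h_X(Y)=\Re\operatorname{Tr}(XY)$ (real part of the trace), $Y\in\mathbb{K}^{n\times n}$, and $h_X^M$ is its restriction to $M$. *)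

theory Defs
  imports "HOL-Analysis.Analysis"
begin

section \<open>Quaternions\<close>

datatype quat = Quat (qre: real) (qi: real) (qj: real) (qk: real)

lemma quat_eq_iff: "x = y \<longleftrightarrow> qre x = qre y \<and> qi x = qi y \<and> qj x = qj y \<and> qk x = qk y"
  by (cases x; cases y) auto

lemma quat_eqI: "qre x = qre y \<Longrightarrow> qi x = qi y \<Longrightarrow> qj x = qj y \<Longrightarrow> qk x = qk y \<Longrightarrow> x = y"
  by (simp add: quat_eq_iff)

instantiation quat :: ring_1
begin

definition "0 = Quat 0 0 0 0"
definition "1 = Quat 1 0 0 0"
definition "x + y = Quat (qre x + qre y) (qi x + qi y) (qj x + qj y) (qk x + qk y)"
definition "- x = Quat (- qre x) (- qi x) (- qj x) (- qk x)"
definition "x - y = Quat (qre x - qre y) (qi x - qi y) (qj x - qj y) (qk x - qk y)"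
definition "x * y = Quat
  (qre x * qre y - qi x * qi y - qj x * qj y - qk x * qk y)
  (qre x * qi y + qi x * qre y + qj x * qk y - qk x * qj y)
  (qre x * qj y - qi x * qk y + qj x * qre y + qk x * qi y)
  (qre x * qk y + qi x * qj y - qj x * qi y + qk x * qre y)"

instance
  by standard
    (simp_all add: zero_quat_def one_quat_def plus_quat_def uminus_quat_def minus_quat_def
      times_quat_def algebra_simps)

end

lemma quat_sel [simp]:
  "qre 0 = 0" "qi 0 = 0" "qj 0 = 0" "qk 0 = 0"
  "qre 1 = 1" "qi 1 = 0" "qj 1 = 0" "qk 1 = 0"
  "qre (x + y) = qre x + qre y" "qi (x + y) = qi x + qi y"
  "qj (x + y) = qj x + qj y" "qk (x + y) = qk x + qk y"
  "qre (- x) = - qre x" "qi (- x) = - qi x" "qj (- x) = - qj x" "qk (- x) = - qk x"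
  "qre (x - y) = qre x - qre y" "qi (x - y) = qi x - qi y"
  "qj (x - y) = qj x - qj y" "qk (x - y) = qk x - qk y"
  by (simp_all add: zero_quat_def one_quat_def plus_quat_def uminus_quat_def minus_quat_def)

lemma quat_times_sel [simp]:
  "qre (x * y) = qre x * qre y - qi x * qi y - qj x * qj y - qk x * qk y"
  "qi (x * y) = qre x * qi y + qi x * qre y + qj x * qk y - qk x * qj y"
  "qj (x * y) = qre x * qj y - qi x * qk y + qj x * qre y + qk x * qi y"
  "qk (x * y) = qre x * qk y + qi x * qj y - qj x * qi y + qk x * qre y"
  by (simp_all add: times_quat_def)

instantiation quat :: real_algebra_1
begin

definition "scaleR r x = Quat (r * qre x) (r * qi x) (r * qj x) (r * qk x)"

instance
  by standard (simp_all add: scaleR_quat_def quat_eq_iff algebra_simps)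

end

lemma quat_scaleR_sel [simp]:
  "qre (r *\<^sub>R x) = r * qre x" "qi (r *\<^sub>R x) = r * qi x"
  "qj (r *\<^sub>R x) = r * qj x" "qk (r *\<^sub>R x) = r * qk x"
  by (simp_all add: scaleR_quat_def)

lemma quat_of_real_sel [simp]:
  "qre (of_real r) = r" "qi (of_real r) = 0" "qj (of_real r) = 0" "qk (of_real r) = 0"
  by (simp_all add: of_real_def)

definition qcnj :: "quat \<Rightarrow> quat"
  where "qcnj x = Quat (qre x) (- qi x) (- qj x) (- qk x)"

lemma qcnj_sel [simp]:
  "qre (qcnj x) = qre x" "qi (qcnj x) = - qi x" "qj (qcnj x) = - qj x" "qk (qcnj x) = - qk x"
  by (simp_all add: qcnj_def)

instantiation quat :: real_div_algebra
begin

definition "inverse x = (1 / ((qre x)\<^sup>2 + (qi x)\<^sup>2 + (qj x)\<^sup>2 + (qk x)\<^sup>2)) *\<^sub>R qcnj x"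
definition "x div y = x * inverse (y :: quat)"

instance
proof
  fix x y :: quat
  show "x div y = x * inverse y"
    by (simp add: divide_quat_def)
  show "inverse (0 :: quat) = 0"
    by (simp add: inverse_quat_def)
  define s where "s = (qre x)\<^sup>2 + (qi x)\<^sup>2 + (qj x)\<^sup>2 + (qk x)\<^sup>2"
  assume "x \<noteq> 0"
  then have s: "s \<noteq> 0"
    unfolding s_def quat_eq_iff by (auto simp: add_nonneg_eq_0_iff)
  have a: "x * qcnj x = of_real s" "qcnj x * x = of_real s"
    by (simp_all add: quat_eq_iff s_def power2_eq_square algebra_simps)
  have inv: "inverse x = (1 / s) *\<^sub>R qcnj x"
    by (simp add: inverse_quat_def s_def)
  show "x * inverse x = 1" "inverse x * x = 1"
    using s by (simp_all add: inv a of_real_def)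
qed

end

instantiation quat :: real_inner
begin

definition "inner x y = qre x * qre y + qi x * qi y + qj x * qj y + qk x * qk y"
definition "norm x = sqrt ((qre x)\<^sup>2 + (qi x)\<^sup>2 + (qj x)\<^sup>2 + (qk x)\<^sup>2)"
definition "dist x y = norm (x - y :: quat)"
definition "sgn x = x /\<^sub>R norm (x :: quat)"
definition "uniformity = (INF e\<in>{0 <..}. principal {(x :: quat, y). dist x y < e})"
definition "open (S :: quat set) \<longleftrightarrow> (\<forall>x\<in>S. \<forall>\<^sub>F (x', y) in uniformity. x' = x \<longrightarrow> y \<in> S)"

instance
proof
  fix x y z :: quat and r :: real and S :: "quat set"
  show "dist x y = norm (x - y)" by (rule dist_quat_def)
  show "sgn x = x /\<^sub>R norm x" by (rule sgn_quat_def)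
  show "(uniformity :: (quat \<times> quat) filter) = (INF e\<in>{0 <..}. principal {(x, y). dist x y < e})"
    by (rule uniformity_quat_def)
  show "open S = (\<forall>x\<in>S. \<forall>\<^sub>F (x', y) in uniformity. x' = x \<longrightarrow> y \<in> S)"
    by (rule open_quat_def)
  show "inner x y = inner y x" "inner (x + y) z = inner x z + inner y z"
    "inner (r *\<^sub>R x) y = r * inner x y"
    by (simp_all add: inner_quat_def algebra_simps)
  show "0 \<le> inner x x" by (simp add: inner_quat_def)
  show "inner x x = 0 \<longleftrightarrow> x = 0"
    unfolding inner_quat_def quat_eq_iff by (auto simp: add_nonneg_eq_0_iff)
  show "norm x = sqrt (inner x x)"
    by (simp add: norm_quat_def inner_quat_def power2_eq_square)
qed

end

instance quat :: real_normed_div_algebra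
proof
  fix x y :: quat
  show "norm (x * y) = norm x * norm y"
    unfolding norm_quat_def real_sqrt_mult [symmetric]
    by (rule arg_cong [where f = sqrt]) (simp add: power2_eq_square algebra_simps)
qed

instantiation quat :: euclidean_space
begin

definition "Basis = {Quat 1 0 0 0, Quat 0 1 0 0, Quat 0 0 1 0, Quat 0 0 0 1}"

instance
proof
  show "(Basis :: quat set) \<noteq> {}" "finite (Basis :: quat set)"
    by (simp_all add: Basis_quat_def)
  show "inner u v = (if u = v then 1 else 0)" if "u \<in> Basis" "v \<in> Basis" for u v :: quat
    using that unfolding Basis_quat_def by (elim insertE emptyE) (simp_all add: inner_quat_def)
  show "(\<forall>u\<in>Basis. inner x u = 0) \<longleftrightarrow> x = 0" for x :: quat
    by (simp add: Basis_quat_def inner_quat_def) (auto simp: quat_eq_iff)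
qed

end


section \<open>The scalars R, C and H\<close>

text \<open>A common interface to the three (skew) fields, so that the notions below need to be defined
  only once. The statement is about the three instances.\<close>

class hypercomplex = real_normed_div_algebra + euclidean_space +
  fixes kcnj :: "'a \<Rightarrow> 'a" and kre :: "'a \<Rightarrow> real"
  assumes kcnj_add: "kcnj (x + y) = kcnj x + kcnj y"
    and kcnj_scaleR: "kcnj (r *\<^sub>R x) = r *\<^sub>R kcnj x"
    and kcnj_mult: "kcnj (x * y) = kcnj y * kcnj x"
    and kcnj_kcnj: "kcnj (kcnj x) = x"
    and add_kcnj: "x + kcnj x = (2 * kre x) *\<^sub>R 1"
    and inner_eq_kre: "inner x y = kre (kcnj x * y)"

instantiation real :: hypercomplex
begin

definition "kcnj x = (x :: real)"
definition "kre x = (x :: real)"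

instance
  by standard (simp_all add: kcnj_real_def kre_real_def algebra_simps)

end

instantiation complex :: hypercomplex
begin

definition "kcnj x = cnj x"
definition "kre x = Re x"

instance
  by standard
    (simp_all add: kcnj_complex_def kre_complex_def complex_eq_iff inner_complex_def algebra_simps)

end

instantiation quat :: hypercomplex
begin

definition "kcnj x = qcnj x"
definition "kre x = qre x"

instance
  by standard
    (simp_all add: kcnj_quat_def kre_quat_def inner_quat_def quat_eq_iff algebra_simps)

end


lemma kcnj_0: "kcnj 0 = (0 :: 'k::hypercomplex)"
  using kcnj_scaleR [of 0 0] by simp

lemma kcnj_1: "kcnj 1 = (1 :: 'k::hypercomplex)"
  using kcnj_mult [of "kcnj 1" "1 :: 'k"] by (simp add: kcnj_kcnj)


section \<open>Groups, involutions and Cartan models\<close>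

definition conj_transpose :: "('k::hypercomplex)^'n^'m \<Rightarrow> 'k^'m^'n"
  where "conj_transpose A = (\<chi> i j. kcnj (A $ j $ i))"

definition orthogonal_group :: "(('k::hypercomplex)^'n^'n) set"
  where "orthogonal_group = {A. A ** conj_transpose A = mat 1}"

lemma mat_1_in_orthogonal_group: "(mat 1 :: ('k::hypercomplex)^'n^'n) \<in> orthogonal_group"
proof -
  have "conj_transpose (mat 1 :: 'k^'n^'n) = mat 1"
    by (simp add: conj_transpose_def mat_def vec_eq_iff kcnj_0 kcnj_1)
  then show ?thesis
    by (simp add: orthogonal_group_def)
qed

text \<open>The identity component of \<open>O(n, K)\<close>, i.e. \<open>SO(n)\<close>, \<open>U(n)\<close> or \<open>Sp(n)\<close>.\<close>

definition identity_component :: "(('k::hypercomplex)^'n^'n) set"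
  where "identity_component = connected_component_set orthogonal_group (mat 1)"

text \<open>Involutive automorphisms of the unital real algebra of \<open>n \<times> n\<close> matrices that commute with
  the conjugate transpose. They restrict to the identity component automatically, see
  \<open>star_involution_image\<close> below. The identity map is not excluded.\<close>

definition star_involution :: "(('k::hypercomplex)^'n^'n \<Rightarrow> 'k^'n^'n) \<Rightarrow> bool"
  where "star_involution \<sigma> \<longleftrightarrow>
    linear \<sigma> \<and> \<sigma> (mat 1) = mat 1 \<and> (\<forall>A B. \<sigma> (A ** B) = \<sigma> A ** \<sigma> B) \<and>
    (\<forall>A. \<sigma> (\<sigma> A) = A) \<and> (\<forall>Y. \<sigma> (conj_transpose Y) = conj_transpose (\<sigma> Y))"

definition cartan_model :: "(('k::hypercomplex)^'n^'n \<Rightarrow> 'k^'n^'n) \<Rightarrow> ('k^'n^'n) set"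
  where "cartan_model \<sigma> = {B ** matrix_inv (\<sigma> B) | B. B \<in> identity_component}"

lemma star_involution_image:
  fixes \<sigma> :: "('k::hypercomplex)^'n^'n \<Rightarrow> 'k^'n^'n"
  assumes "star_involution \<sigma>"
  shows "\<sigma> ` identity_component = identity_component"
proof -
  have lin: "linear \<sigma>" and one: "\<sigma> (mat 1) = mat 1"
    and mult: "\<And>A B. \<sigma> (A ** B) = \<sigma> A ** \<sigma> B" and inv: "\<And>A. \<sigma> (\<sigma> A) = A"
    and star: "\<And>A. \<sigma> (conj_transpose A) = conj_transpose (\<sigma> A)"
    using assms by (auto simp: star_involution_def)
  let ?O = "orthogonal_group :: ('k^'n^'n) set" and ?G = "identity_component :: ('k^'n^'n) set"
  have O: "\<sigma> ` ?O \<subseteq> ?O"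
    using one by (auto simp: orthogonal_group_def simp flip: mult star)
  have "connected (\<sigma> ` ?G)"
    by (intro connected_continuous_image linear_continuous_on)
      (simp_all add: lin linear_conv_bounded_linear [symmetric] identity_component_def)
  moreover have "mat 1 \<in> ?G"
    by (simp add: identity_component_def connected_component_refl mat_1_in_orthogonal_group)
  then have "mat 1 \<in> \<sigma> ` ?G"
    using one by (metis imageI)
  moreover have "\<sigma> ` ?G \<subseteq> ?O"
    using O connected_component_subset [of ?O "mat 1"] unfolding identity_component_def by blast
  ultimately have sub: "\<sigma> ` ?G \<subseteq> ?G"
    unfolding identity_component_def by (intro connected_component_maximal)
  moreover have "x \<in> \<sigma> ` ?G" if "x \<in> ?G" for x
    using sub that inv [of x] by (metis image_eqI image_subset_iff)
  ultimately show ?thesis by blast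
qed


section \<open>Critical points of the height function\<close>

text \<open>\<open>D k\<close> is the \<open>k\<close>-th derivative of \<open>\<gamma>\<close>.\<close>

definition smooth_curve_on :: "real set \<Rightarrow> (real \<Rightarrow> 'a::real_normed_vector) \<Rightarrow> bool"
  where "smooth_curve_on T \<gamma> \<longleftrightarrow>
    (\<exists>D :: nat \<Rightarrow> real \<Rightarrow> 'a. D 0 = \<gamma> \<and>
      (\<forall>k. \<forall>t\<in>T. (D k has_vector_derivative D (Suc k) t) (at t)))"

text \<open>Velocities of smooth curves inside \<open>M\<close>; for an embedded submanifold \<open>M\<close> of the ambient space
  this is the tangent space at \<open>A\<close>.\<close>

definition tangent_space :: "'a::real_normed_vector set \<Rightarrow> 'a \<Rightarrow> 'a set"
  where "tangent_space M A =
    {v. \<exists>e>0. \<exists>\<gamma>. smooth_curve_on {-e<..<e} \<gamma> \<and> \<gamma> ` {-e<..<e} \<subseteq> M \<and> \<gamma> 0 = A \<and>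
        (\<gamma> has_vector_derivative v) (at 0)}"

text \<open>The differential at \<open>A\<close> of the restriction of \<open>f\<close> to \<open>M\<close> vanishes on the tangent space. Being
  taken within \<open>M\<close>, it only involves the values of \<open>f\<close> on \<open>M\<close>.\<close>

definition critical_point_on :: "'a::real_normed_vector set \<Rightarrow> ('a \<Rightarrow> real) \<Rightarrow> 'a \<Rightarrow> bool"
  where "critical_point_on M f A \<longleftrightarrow> A \<in> M \<and>
    (\<exists>f'. (f has_derivative f') (at A within M) \<and> (\<forall>v\<in>tangent_space M A. f' v = 0))"

definition height :: "('k::hypercomplex)^'n^'n \<Rightarrow> 'k^'n^'n \<Rightarrow> real"
  where "height X Y = kre (trace (X ** Y))"

definition hat :: "(('k::hypercomplex)^'n^'n \<Rightarrow> 'k^'n^'n) \<Rightarrow> 'k^'n^'n \<Rightarrow> 'k^'n^'n"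
  where "hat \<sigma> X = conj_transpose X + \<sigma> X"

end

(* A tangent vector of M at A satisfies sigma(v) = v^* and A v^* + v A^* = 0. Conversely, for such v
   and A = B sigma(B)^*, the matrix W = B^* v sigma(B) is skew with sigma(W) = -W; with c the Cayley
   transform of t W / 4 one has sigma(c) = c^*, and B c c sigma(B)^* = (B c) sigma(B c)^* is a curve
   in M with velocity v. As sigma preserves Re Tr, it is an isometry, whence 2 h_X(v) = <hat X, v> on
   the tangent space. Finally Z = hat X - A sigma(hat X) A is itself tangent, and <Z, v> = 4 h_X(v)
   for tangent v, so that h_X vanishes on the tangent space iff Z = 0. *)

theory Submission
  imports Defs
begin

section \<open>Trace form and conjugate transpose\<close>

text \<open>Interpreting the product as a bounded bilinear map supplies its algebraic, limit and
  derivative rules for all three scalar types at once.\<close>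

lemma bounded_bilinear_matrix_mult:
  "bounded_bilinear ((**) :: ('k::hypercomplex)^'n^'m \<Rightarrow> 'k^'p^'n \<Rightarrow> 'k^'p^'m)"
  unfolding bilinear_conv_bounded_bilinear [symmetric] bilinear_def
  by (auto intro!: linearI simp: matrix_matrix_mult_def vec_eq_iff algebra_simps sum.distrib
      scaleR_sum_right)

interpretation matrix_mult: bounded_bilinear
  "(**) :: ('k::hypercomplex)^'n^'m \<Rightarrow> 'k^'p^'n \<Rightarrow> 'k^'p^'m"
  by (rule bounded_bilinear_matrix_mult)

lemma kre_eq_inner: "kre x = inner 1 (x :: 'k::hypercomplex)"
  by (simp add: inner_eq_kre kcnj_1)

lemma kre_add: "kre (x + y) = kre x + kre (y :: 'k::hypercomplex)"
  and kre_scaleR: "kre (r *\<^sub>R x) = r * kre x"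
  by (simp_all add: kre_eq_inner inner_add_right)

text \<open>Since \<open>z + kcnj z\<close> is twice the real part of \<open>z\<close>, conjugation
  is the reflection in the real line spanned by the unit vector 1.\<close>

lemma inner_kcnj: "inner (kcnj x) (kcnj y) = inner x (y :: 'k::hypercomplex)"
proof -
  have kcnj_eq: "kcnj z = (2 * inner 1 z) *\<^sub>R 1 - z" for z :: 'k
    using add_kcnj [of z] by (simp add: kre_eq_inner algebra_simps)
  have "inner (1 :: 'k) 1 = 1"
    by (simp flip: power2_norm_eq_inner)
  then show ?thesis
    by (simp add: kcnj_eq inner_diff_left inner_diff_right inner_commute [of x 1] algebra_simps)
qed

section \<open>Conjugate transpose and the trace form\<close>

lemma conj_transpose_component: "conj_transpose A $ i $ j = kcnj (A $ j $ i)"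
  by (simp add: conj_transpose_def)

lemma kcnj_sum: "kcnj (sum f S) = (\<Sum>i\<in>S. kcnj (f i :: 'k::hypercomplex))"
  by (induction S rule: infinite_finite_induct) (simp_all add: kcnj_0 kcnj_add)

lemma conj_transpose_mult:
  "conj_transpose (A ** B) = conj_transpose B ** conj_transpose (A :: ('k::hypercomplex)^'n^'m)"
  by (simp add: vec_eq_iff matrix_matrix_mult_def conj_transpose_component kcnj_sum kcnj_mult)

lemma conj_transpose_conj_transpose [simp]: "conj_transpose (conj_transpose A) = A"
  by (simp add: vec_eq_iff conj_transpose_component kcnj_kcnj)

lemma linear_conj_transpose: "linear (conj_transpose :: ('k::hypercomplex)^'n^'m \<Rightarrow> _)"
  by (rule linearI) (simp_all add: vec_eq_iff conj_transpose_component kcnj_add kcnj_scaleR)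

lemmas conj_transpose_simps =
  linear_add [OF linear_conj_transpose] linear_diff [OF linear_conj_transpose]
  linear_neg [OF linear_conj_transpose] linear_scale [OF linear_conj_transpose]
  conj_transpose_mult

lemma conj_transpose_mat_1 [simp]: "conj_transpose (mat 1) = (mat 1 :: ('k::hypercomplex)^'n^'n)"
  by (simp add: vec_eq_iff conj_transpose_component mat_def kcnj_0 kcnj_1)

text \<open>Turns the height function into a linear functional, so that being critical becomes an
  orthogonality condition.\<close>

lemma height_eq_inner: "height X Y = inner (conj_transpose X) Y"
proof -
  have "height X Y = (\<Sum>i\<in>UNIV. \<Sum>j\<in>UNIV. kre (X $ i $ j * Y $ j $ i))"
    by (simp add: height_def trace_def matrix_matrix_mult_def kre_eq_inner inner_sum_right)
  also have "\<dots> = inner (conj_transpose X) Y"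
    by (subst sum.swap) (simp add: inner_vec_def conj_transpose_component inner_eq_kre kcnj_kcnj)
  finally show ?thesis .
qed

lemma inner_conj_transpose:
  "inner (conj_transpose A) (conj_transpose B) = inner A (B :: ('k::hypercomplex)^'n^'m)"
  by (simp add: inner_vec_def conj_transpose_component inner_kcnj)
    (rule sum.swap)

lemma inner_eq_height: "inner A B = height (conj_transpose A) B"
  by (simp add: height_eq_inner)

text \<open>Both sides are the real trace of \<open>B^* A^* C\<close>.\<close>

lemma inner_mult_left:
  fixes A B C :: "('k::hypercomplex)^'n^'n"
  shows "inner (A ** B) C = inner B (conj_transpose A ** C)"
  by (simp add: inner_eq_height height_def conj_transpose_mult matrix_mul_assoc)

text \<open>The left version with all three matrices replaced by their conjugate transposes; this
  avoids cyclicity of the trace over noncommutative scalars.\<close>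

lemma inner_mult_right:
  fixes A B C :: "('k::hypercomplex)^'n^'n"
  shows "inner (A ** B) C = inner A (C ** conj_transpose B)"
  using inner_mult_left [of "conj_transpose B" "conj_transpose A" "conj_transpose C"]
  by (metis conj_transpose_conj_transpose conj_transpose_mult inner_conj_transpose)

section \<open>Inverses of square matrices\<close>

text \<open>Left multiplication by \<open>A\<close> is an injective real-linear endomorphism of the
  finite-dimensional space of square matrices, hence surjective. No determinant enters, so
  quaternions are covered.\<close>

lemma invertible_if_left_cancel:
  fixes A :: "('k::hypercomplex)^'n^'n"
  assumes "\<And>Z :: 'k^'n^'n. A ** Z = 0 \<Longrightarrow> Z = 0"
  shows "invertible A"
proof -
  have lin: "linear ((**) A :: 'k^'n^'n \<Rightarrow> _)"
    by (simp add: linear_conv_bounded_linear matrix_mult.bounded_linear_right)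
  have inj: "inj ((**) A :: 'k^'n^'n \<Rightarrow> _)"
    using assms linear_injective_0 [OF lin] by blast
  then have "surj ((**) A :: 'k^'n^'n \<Rightarrow> _)"
    by (rule linear_injective_imp_surjective [OF lin]) (rule refl)
  then obtain B :: "'k^'n^'n" where B: "A ** B = mat 1"
    by (metis surjD)
  then have "A ** (B ** A) = A ** mat 1"
    by (simp add: matrix_mul_assoc)
  with inj have "B ** A = mat 1"
    by (rule injD)
  with B show ?thesis
    by (auto simp: invertible_def)
qed

text \<open>\<open>B\<close> is left cancellable because \<open>A\<close> undoes it, hence
  invertible, and its left inverse \<open>A\<close> must be its inverse.\<close>

lemma matrix_inverse_comm:
  fixes A B :: "('k::hypercomplex)^'n^'n"
  assumes "A ** B = mat 1"
  shows "B ** A = mat 1"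
proof -
  have "invertible B"
  proof (rule invertible_if_left_cancel)
    fix Z :: "'k^'n^'n"
    assume "B ** Z = 0"
    then show "Z = 0"
      using assms by (metis matrix_mul_assoc matrix_mul_lid matrix_mult.zero_right)
  qed
  then show ?thesis
    using assms unfolding invertible_def by (metis matrix_mul_assoc matrix_mul_lid matrix_mul_rid)
qed

lemma matrix_inv_inverse:
  fixes A :: "'k::semiring_1^'n^'n"
  assumes "invertible A"
  shows "A ** matrix_inv A = mat 1" "matrix_inv A ** A = mat 1"
  using someI_ex [OF assms [unfolded invertible_def]] by (simp_all add: matrix_inv_def)

lemma matrix_inv_eqI:
  fixes A B :: "('k::hypercomplex)^'n^'n"
  assumes "A ** B = mat 1"
  shows "matrix_inv A = B"
proof -
  have "invertible A"
    using assms matrix_inverse_comm [OF assms] by (auto simp: invertible_def)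
  then show ?thesis
    using matrix_inv_inverse [of A] assms by (metis matrix_mul_assoc matrix_mul_lid matrix_mul_rid)
qed

section \<open>Traces and star involutions\<close>

text \<open>This is tr(fg) = tr(gf) for real-linear endomorphisms, with traces written in the
  orthonormal basis.\<close>

lemma sum_Basis_inner_commute:
  fixes f g :: "'a::euclidean_space \<Rightarrow> 'a"
  assumes "linear f" "linear g"
  shows "(\<Sum>b\<in>Basis. inner (f (g b)) b) = (\<Sum>b\<in>Basis. inner (g (f b)) b)"
proof -
  have expand: "inner (f' (g' b)) b = (\<Sum>c\<in>Basis. inner (g' b) c * inner (f' c) b)"
    if "linear f'" for f' g' :: "'a \<Rightarrow> 'a" and b
  proof -
    have "f' (g' b) = f' (\<Sum>c\<in>Basis. inner (g' b) c *\<^sub>R c)"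
      by (simp add: euclidean_representation)
    then show ?thesis
      by (simp add: linear_sum [OF that] linear_scale [OF that] inner_sum_left)
  qed
  show ?thesis
    unfolding expand [OF assms(1), of g] expand [OF assms(2), of f]
    by (subst sum.swap) (simp add: mult.commute)
qed

lemma sum_Basis_vec:
  "(\<Sum>b\<in>(Basis :: ('a::euclidean_space^'n) set). h b) = (\<Sum>i\<in>UNIV. \<Sum>u\<in>Basis. h (axis i u))"
proof -
  have "(Basis :: ('a^'n) set) = (\<Union>i\<in>UNIV. axis i ` Basis)"
    by (auto simp: Basis_vec_def)
  then have "(\<Sum>b\<in>(Basis :: ('a^'n) set). h b) = sum h (\<Union>i\<in>UNIV. axis i ` Basis)"
    by (rule arg_cong)
  also have "\<dots> = (\<Sum>i\<in>UNIV. sum h (axis i ` Basis))"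
    by (rule sum.UNION_disjoint) (auto simp: axis_eq_axis)
  also have "\<dots> = (\<Sum>i\<in>UNIV. \<Sum>u\<in>Basis. h (axis i u))"
    by (intro sum.cong refl sum.reindex_cong [where l = "axis _"]) (auto simp: inj_on_def axis_eq_axis)
  finally show ?thesis .
qed

text \<open>Symmetrizing the left side replaces \<open>q\<close> by \<open>q + kcnj q\<close>, a
  real scalar, which commutes with \<open>c\<close>.\<close>

lemma inner_mult_self: "inner (q * c) c = kre q * inner c (c :: 'k::hypercomplex)"
proof -
  have "inner (q * c) c + inner c (q * c) = kre (kcnj c * (q + kcnj q) * c)"
    by (simp add: inner_eq_kre kcnj_mult kre_add algebra_simps)
  also have "\<dots> = 2 * kre q * inner c c"
    by (simp add: add_kcnj inner_eq_kre kre_scaleR)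
  finally show ?thesis
    by (simp add: inner_commute)
qed

text \<open>Computes the real trace of left multiplication by \<open>Y\<close>: each diagonal entry
  contributes its real part once per column and per real basis element of the scalars.\<close>

lemma trace_left_mult:
  fixes Y :: "('k::hypercomplex)^'n^'n"
  shows "(\<Sum>b\<in>(Basis :: ('k^'n^'n) set). inner (Y ** b) b) = real CARD('n) * real DIM('k) * inner (mat 1) Y"
proof -
  have "(Y ** axis i (axis j c)) $ i $ j = Y $ i $ i * c" for i j :: 'n and c :: 'k
    by (simp add: matrix_matrix_mult_def axis_def if_distrib [of "\<lambda>v. v $ _"]
        if_distrib [of "(*) _"] cong: if_cong)
  then have "(\<Sum>b\<in>(Basis :: ('k^'n^'n) set). inner (Y ** b) b) =
    (\<Sum>i\<in>UNIV. \<Sum>j\<in>(UNIV :: 'n set). \<Sum>c\<in>(Basis :: 'k set). inner (Y $ i $ i * c) c)"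
    by (simp add: sum_Basis_vec inner_axis)
  also have "\<dots> = real CARD('n) * real DIM('k) * (\<Sum>i\<in>UNIV. kre (Y $ i $ i))"
    by (simp add: inner_mult_self sum_distrib_left mult.assoc)
  also have "(\<Sum>i\<in>UNIV. kre (Y $ i $ i)) = inner (mat 1) Y"
    by (simp add: inner_eq_height height_def trace_def kre_eq_inner inner_sum_right)
  finally show ?thesis .
qed

section \<open>Star involutions as isometries\<close>

locale star_involutive =
  fixes \<sigma> :: "('k::hypercomplex)^'n^'n \<Rightarrow> 'k^'n^'n"
  assumes star_involution: "star_involution \<sigma>"
begin

lemma linear: "linear \<sigma>"
  and mat_1 [simp]: "\<sigma> (mat 1) = mat 1"
  and mult: "\<sigma> (A ** B) = \<sigma> A ** \<sigma> B"
  and involution [simp]: "\<sigma> (\<sigma> A) = A"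
  and conj_transpose: "\<sigma> (conj_transpose A) = conj_transpose (\<sigma> A)"
  using star_involution by (auto simp: star_involution_def)

lemmas simps = linear_add [OF linear] linear_diff [OF linear] linear_neg [OF linear]
  linear_scale [OF linear] mult conj_transpose

text \<open>Left multiplication by \<open>\<sigma> Y\<close> is conjugate under \<open>\<sigma>\<close> to left multiplication by \<open>Y\<close>, and the
  trace of the latter is a fixed multiple of \<open>Re Tr Y\<close>.\<close>

lemma inner_mat_1: "inner (mat 1) (\<sigma> Y) = inner (mat 1) Y"
proof -
  have "(\<Sum>b\<in>(Basis :: ('k^'n^'n) set). inner (\<sigma> Y ** b) b) = (\<Sum>b\<in>Basis. inner (\<sigma> (Y ** \<sigma> b)) b)"
    by (simp add: simps)
  also have "\<dots> = (\<Sum>b\<in>Basis. inner (Y ** \<sigma> (\<sigma> b)) b)"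
    by (rule sum_Basis_inner_commute [of \<sigma> "\<lambda>b. Y ** \<sigma> b"])
      (simp_all add: linear linear_conv_bounded_linear [symmetric] linearI simps
        matrix_mult.add_right matrix_mult.scaleR_right)
  finally show ?thesis
    by (simp add: trace_left_mult)
qed

text \<open>The inner product is the real trace of \<open>A^* B\<close>, and \<sigma> respects
  products, conjugate transposes and real traces.\<close>

lemma inner: "inner (\<sigma> A) (\<sigma> B) = inner A B"
proof -
  have "inner (\<sigma> A) (\<sigma> B) = inner (mat 1) (\<sigma> (conj_transpose A ** B))"
    using inner_mult_left [of "\<sigma> A" "mat 1" "\<sigma> B"] by (simp add: simps)
  then show ?thesis
    using inner_mult_left [of A "mat 1" B] by (simp add: inner_mat_1)
qed

end

section \<open>Smooth curves\<close>

text \<open>Choosing a derivative operator \<open>d\<close> on the class \<open>P\<close> and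
  iterating it yields the whole sequence of higher derivatives.\<close>

lemma smooth_curve_on_coinduct:
  assumes "P \<gamma>"
    and step: "\<And>f. P f \<Longrightarrow> \<exists>g. P g \<and> (\<forall>t\<in>T. (f has_vector_derivative g t) (at t))"
  shows "smooth_curve_on T \<gamma>"
proof -
  obtain d where d: "\<And>f. P f \<Longrightarrow> P (d f) \<and> (\<forall>t\<in>T. (f has_vector_derivative d f t) (at t))"
    using step by metis
  have "P ((d ^^ k) \<gamma>)" for k
    by (induction k) (use assms(1) d in auto)
  then show ?thesis
    unfolding smooth_curve_on_def using d by (intro exI [of _ "\<lambda>k. (d ^^ k) \<gamma>"]) auto
qed

text \<open>Closed under differentiation when \<open>R\<close> is a resolvent, as then \<open>R' = R Y R\<close>.\<close>

inductive matrix_polynomial ::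
  "(real \<Rightarrow> ('k::hypercomplex)^'n^'n) \<Rightarrow> (real \<Rightarrow> 'k^'n^'n) \<Rightarrow> bool"
  for R where
  var: "matrix_polynomial R R"
| const: "matrix_polynomial R (\<lambda>t. C)"
| add: "matrix_polynomial R f \<Longrightarrow> matrix_polynomial R g \<Longrightarrow> matrix_polynomial R (\<lambda>t. f t + g t)"
| mult: "matrix_polynomial R f \<Longrightarrow> matrix_polynomial R g \<Longrightarrow> matrix_polynomial R (\<lambda>t. f t ** g t)"

lemma matrix_polynomial_derivative:
  assumes "matrix_polynomial R f"
    and "\<And>t. (R has_vector_derivative R t ** Y ** R t) (at t)"
  shows "\<exists>g. matrix_polynomial R g \<and> (\<forall>t. (f has_vector_derivative g t) (at t))"
  using assms(1)
proof induction
  case var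
  show ?case
    using assms(2) matrix_polynomial.intros
    by (intro exI [of _ "\<lambda>t. R t ** Y ** R t"] conjI matrix_polynomial.mult) auto
next
  case (const C)
  show ?case
    by (intro exI [of _ "\<lambda>t. 0"]) (auto intro: matrix_polynomial.intros)
next
  case (add f g)
  then obtain f' g' where "matrix_polynomial R f'" "\<forall>t. (f has_vector_derivative f' t) (at t)"
    "matrix_polynomial R g'" "\<forall>t. (g has_vector_derivative g' t) (at t)"
    by blast
  then show ?case
    by (intro exI [of _ "\<lambda>t. f' t + g' t"])
      (auto intro: matrix_polynomial.intros has_vector_derivative_add)
next
  case (mult f g)
  then obtain f' g' where "matrix_polynomial R f'" "\<forall>t. (f has_vector_derivative f' t) (at t)"
    "matrix_polynomial R g'" "\<forall>t. (g has_vector_derivative g' t) (at t)"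
    by blast
  with mult show ?case
    by (intro exI [of _ "\<lambda>t. f t ** g' t + f' t ** g t"])
      (auto intro: matrix_polynomial.intros matrix_mult.has_vector_derivative)
qed

lemma smooth_curve_on_matrix_polynomial:
  assumes "matrix_polynomial R f" "\<And>t. (R has_vector_derivative R t ** Y ** R t) (at t)"
  shows "smooth_curve_on T f"
  by (rule smooth_curve_on_coinduct [where P = "matrix_polynomial R"])
    (use assms(1) matrix_polynomial_derivative [OF _ assms(2)] in blast)+

section \<open>The Cayley transform\<close>

locale skew_matrix =
  fixes Y :: "('k::hypercomplex)^'n^'n"
  assumes skew: "conj_transpose Y = - Y"
begin

definition resolvent :: "real \<Rightarrow> 'k^'n^'n"
  where "resolvent t = matrix_inv (mat 1 - t *\<^sub>R Y)"

text \<open>This is \<open>(1 + tY)(1 - tY)^-1\<close>. The form as a sum with a constant makes it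
  visibly a matrix polynomial in the resolvent.\<close>

definition cayley :: "real \<Rightarrow> 'k^'n^'n"
  where "cayley t = 2 *\<^sub>R resolvent t + (- mat 1)"

lemma inner_mult_skew: "inner (Y ** Z) (Z :: 'k^'n^'n) = 0"
  using inner_mult_left [of Y Z Z] by (simp add: skew matrix_mult.minus_left inner_commute)

text \<open>The cross terms vanish because \<open>Y\<close> is skew. Hence \<open>1 - tY\<close> is
  invertible for every real \<open>t\<close>, with a norm-nonincreasing inverse.\<close>

lemma norm_le: "norm (Z :: 'k^'n^'n) \<le> norm ((mat 1 - t *\<^sub>R Y) ** Z)"
proof -
  have "inner ((mat 1 - t *\<^sub>R Y) ** Z) ((mat 1 - t *\<^sub>R Y) ** Z) =
      inner Z Z + t\<^sup>2 * inner (Y ** Z) (Y ** Z)"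
    by (simp add: matrix_mult.diff_left matrix_mult.scaleR_left inner_diff_left inner_diff_right
        inner_mult_skew inner_commute [of Z "Y ** Z"] power2_eq_square)
  then have "inner Z Z \<le> inner ((mat 1 - t *\<^sub>R Y) ** Z) ((mat 1 - t *\<^sub>R Y) ** Z)"
    by simp
  then show ?thesis
    by (simp add: norm_eq_sqrt_inner)
qed

lemma resolvent_inverse:
  "(mat 1 - t *\<^sub>R Y) ** resolvent t = mat 1" "resolvent t ** (mat 1 - t *\<^sub>R Y) = mat 1"
proof -
  have "invertible (mat 1 - t *\<^sub>R Y)"
    by (rule invertible_if_left_cancel) (metis norm_le norm_le_zero_iff norm_zero)
  then show "(mat 1 - t *\<^sub>R Y) ** resolvent t = mat 1" "resolvent t ** (mat 1 - t *\<^sub>R Y) = mat 1"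
    by (simp_all add: resolvent_def matrix_inv_inverse)
qed

lemma resolvent_0 [simp]: "resolvent 0 = mat 1"
  using resolvent_inverse [of 0] by simp

lemma norm_resolvent_mult_le: "norm (resolvent t ** Z) \<le> norm (Z :: 'k^'n^'n)"
  using norm_le [of "resolvent t ** Z" t] by (simp add: matrix_mul_assoc resolvent_inverse)

text \<open>Multiply \<open>(1 - tY) - (1 - sY) = (s - t)Y\<close> by the two resolvents, one on
  each side.\<close>

lemma resolvent_identity: "resolvent s - resolvent t = (s - t) *\<^sub>R (resolvent s ** Y ** resolvent t)"
proof -
  have "resolvent s ** ((mat 1 - t *\<^sub>R Y) - (mat 1 - s *\<^sub>R Y)) ** resolvent t =
      resolvent s ** ((mat 1 - t *\<^sub>R Y) ** resolvent t) -
      (resolvent s ** (mat 1 - s *\<^sub>R Y)) ** resolvent t"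
    by (simp only: matrix_mult.diff_left matrix_mult.diff_right matrix_mul_assoc)
  also have "\<dots> = resolvent s - resolvent t"
    by (simp add: resolvent_inverse)
  finally show ?thesis
    by (simp add: matrix_mult.scaleR_left matrix_mult.scaleR_right flip: scaleR_left_diff_distrib)
qed

text \<open>The resolvent identity and the contraction bound give a Lipschitz estimate at
  \<open>t\<close>.\<close>

lemma resolvent_tendsto: "(resolvent \<longlongrightarrow> resolvent t) (at t)"
proof -
  have "((\<lambda>s. resolvent s - resolvent t) \<longlongrightarrow> 0) (at t)"
  proof (rule Lim_null_comparison)
    have "norm (resolvent s - resolvent t) \<le> \<bar>s - t\<bar> * norm (Y ** resolvent t)" for s
      by (simp add: resolvent_identity mult_left_mono norm_resolvent_mult_le flip: matrix_mul_assoc)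
    then show "\<forall>\<^sub>F s in at t. norm (resolvent s - resolvent t) \<le>
        \<bar>s - t\<bar> * norm (Y ** resolvent t)"
      by simp
    show "((\<lambda>s. \<bar>s - t\<bar> * norm (Y ** resolvent t)) \<longlongrightarrow> 0) (at t)"
      by (rule tendsto_eq_intros refl | simp)+
  qed
  then show ?thesis
    by (rule LIM_zero_cancel)
qed

lemma resolvent_derivative:
  "(resolvent has_vector_derivative resolvent t ** Y ** resolvent t) (at t)"
proof -
  have bl: "bounded_linear (\<lambda>h. h *\<^sub>R (resolvent t ** Y ** resolvent t))"
    by (rule bounded_linear_scaleR_left)
  let ?err = "\<lambda>s. resolvent s - resolvent t - (s - t) *\<^sub>R (resolvent t ** Y ** resolvent t)"
  have "((\<lambda>s. ?err s /\<^sub>R norm (s - t)) \<longlongrightarrow> 0) (at t)"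
  proof (rule Lim_null_comparison)
    have "?err s = (s - t) *\<^sub>R ((resolvent s - resolvent t) ** Y ** resolvent t)" for s
      \<comment> \<open>Placing the identity in the context \<open>D - _\<close> rewrites only the
        minuend on the left; the difference of resolvents on the right must survive.\<close>
      unfolding resolvent_identity [of s t, THEN arg_cong [of _ _ "\<lambda>D. D - _"]]
      by (simp only: matrix_mult.diff_left scaleR_right_diff_distrib)
    then show "\<forall>\<^sub>F s in at t. norm (?err s /\<^sub>R norm (s - t)) \<le>
        norm ((resolvent s - resolvent t) ** Y ** resolvent t)"
      by (simp add: eventually_at_filter abs_mult)
    have "((\<lambda>s. (resolvent s - resolvent t) ** Y ** resolvent t) \<longlongrightarrow>
        (resolvent t - resolvent t) ** Y ** resolvent t) (at t)"
      by (intro matrix_mult.tendsto tendsto_diff resolvent_tendsto tendsto_const)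
    then show "((\<lambda>s. norm ((resolvent s - resolvent t) ** Y ** resolvent t)) \<longlongrightarrow> 0) (at t)"
      by (simp add: tendsto_norm_zero matrix_mult.zero_left)
  qed
  with bl show ?thesis
    by (simp add: has_vector_derivative_def has_derivative_at_within)
qed

lemma smooth_curve_on_cayley:
  fixes B C :: "'k^'n^'n"
  shows "smooth_curve_on T (\<lambda>t. B ** (cayley t ** cayley t) ** C)"
proof (rule smooth_curve_on_matrix_polynomial [OF _ resolvent_derivative])
  show "matrix_polynomial resolvent (\<lambda>t. B ** (cayley t ** cayley t) ** C)"
    unfolding cayley_def scaleR_2 by (intro matrix_polynomial.intros)
qed

lemma cayley_derivative: "(cayley has_vector_derivative 2 *\<^sub>R (resolvent t ** Y ** resolvent t)) (at t)"
proof -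
  have "((\<lambda>t. 2 *\<^sub>R resolvent t + - mat 1) has_vector_derivative
      2 *\<^sub>R (resolvent t ** Y ** resolvent t) + 0) (at t)"
    by (intro has_vector_derivative_add has_vector_derivative_const
        bounded_linear.has_vector_derivative [OF bounded_linear_scaleR_right] resolvent_derivative)
  then show ?thesis
    by (simp add: cayley_def [abs_def])
qed

lemma cayley_0 [simp]: "cayley 0 = mat 1"
  by (simp add: cayley_def scaleR_2)

lemma cayley_orthogonal: "cayley t ** conj_transpose (cayley t) = mat 1"
proof -
  let ?R = "resolvent t"
  have star: "(mat 1 + t *\<^sub>R Y) ** conj_transpose ?R = mat 1"
    using arg_cong [OF resolvent_inverse(2) [of t], of conj_transpose]
    by (simp add: conj_transpose_simps skew)
  \<comment> \<open>Expanding \<open>(2R - 1)(2R^* - 1)\<close> shows that orthogonality amounts to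
    \<open>R + R^* = 2RR^*\<close>; here each summand is written as \<open>RR^*\<close> plus or
    minus \<open>t R Y R^*\<close>.\<close>
  have "?R + conj_transpose ?R =
      ?R ** ((mat 1 + t *\<^sub>R Y) ** conj_transpose ?R) + (?R ** (mat 1 - t *\<^sub>R Y)) ** conj_transpose ?R"
    by (simp add: star resolvent_inverse)
  also have "\<dots> = 2 *\<^sub>R (?R ** conj_transpose ?R)"
    by (simp add: matrix_mult.add_left matrix_mult.add_right matrix_mult.diff_left
        matrix_mult.diff_right matrix_mul_assoc scaleR_2)
  finally have "2 *\<^sub>R (?R ** conj_transpose ?R) - conj_transpose ?R = ?R"
    by (metis add_diff_cancel_right')
  then show ?thesis
    by (simp add: cayley_def conj_transpose_simps matrix_mult.add_left matrix_mult.add_right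
        matrix_mult.diff_left matrix_mult.diff_right matrix_mult.minus_left
        matrix_mult.minus_right matrix_mult.scaleR_left matrix_mult.scaleR_right)
qed

text \<open>The curve \<open>B ** cayley t\<close> stays in the orthogonal group and passes through
  \<open>B\<close> at parameter 0, so it cannot leave the component.\<close>

lemma cayley_in_identity_component:
  assumes "B \<in> identity_component"
  shows "B ** cayley t \<in> identity_component"
proof -
  let ?f = "\<lambda>t. B ** cayley t"
  have B: "connected_component orthogonal_group (mat 1) B"
    using assms by (simp add: identity_component_def)
  then have BO: "B ** conj_transpose B = mat 1"
    using connected_component_in [OF B] by (simp add: orthogonal_group_def)
  have "continuous_on UNIV cayley"
    using cayley_derivative
    by (intro continuous_at_imp_continuous_on) (blast intro: has_vector_derivative_continuous)
  then have "connected (range ?f)"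
    by (intro connected_continuous_image matrix_mult.continuous_on continuous_on_const) auto
  moreover have "range ?f \<subseteq> orthogonal_group"
  proof clarify
    fix t
    have "?f t ** conj_transpose (?f t) =
        B ** (cayley t ** conj_transpose (cayley t)) ** conj_transpose B"
      by (simp only: conj_transpose_mult matrix_mul_assoc)
    then show "?f t \<in> orthogonal_group"
      by (simp add: orthogonal_group_def cayley_orthogonal BO)
  qed
  moreover have "B \<in> range ?f"
    by (rule range_eqI [of _ _ 0]) simp
  ultimately have "connected_component orthogonal_group B (?f t)"
    unfolding connected_component_def by blast
  with B show ?thesis
    unfolding identity_component_def by (auto intro: connected_component_trans)
qed

end

section \<open>Tangent spaces of Cartan models\<close>

lemma identity_component_orthogonal:
  assumes "B \<in> identity_component"
  shows "B ** conj_transpose B = mat 1" "conj_transpose B ** B = mat 1"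
proof -
  show "B ** conj_transpose B = mat 1"
    using assms connected_component_subset [of orthogonal_group]
    by (auto simp: identity_component_def orthogonal_group_def)
  then show "conj_transpose B ** B = mat 1"
    by (rule matrix_inverse_comm)
qed

context star_involutive
begin

lemma orthogonal_image:
  assumes "B \<in> identity_component"
  shows "\<sigma> B ** conj_transpose (\<sigma> B) = mat 1" "conj_transpose (\<sigma> B) ** \<sigma> B = mat 1"
  using identity_component_orthogonal [OF assms] by (metis mat_1 mult conj_transpose)+

lemma cartan_model_eq:
  "cartan_model \<sigma> = {B ** conj_transpose (\<sigma> B) | B. B \<in> identity_component}"
proof -
  have "matrix_inv (\<sigma> B) = conj_transpose (\<sigma> B)" if "B \<in> identity_component" for B
    using orthogonal_image(1) [OF that] by (rule matrix_inv_eqI)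
  then show ?thesis
    unfolding cartan_model_def by (metis (no_types, lifting))
qed

text \<open>These equations on \<open>A\<close> are the ones that get linearized to describe the
  tangent space.\<close>

lemma cartan_model_orthogonal:
  assumes "A \<in> cartan_model \<sigma>"
  shows "A ** conj_transpose A = mat 1" "conj_transpose A ** A = mat 1" "\<sigma> A = conj_transpose A"
proof -
  obtain B where B: "B \<in> identity_component" and A: "A = B ** conj_transpose (\<sigma> B)"
    using assms by (auto simp: cartan_model_eq)
  have "A ** conj_transpose A = B ** (conj_transpose (\<sigma> B) ** \<sigma> B) ** conj_transpose B"
    by (simp only: A conj_transpose_mult conj_transpose_conj_transpose matrix_mul_assoc)
  then show AA: "A ** conj_transpose A = mat 1"
    by (simp add: orthogonal_image [OF B] identity_component_orthogonal [OF B])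
  then show "conj_transpose A ** A = mat 1"
    by (rule matrix_inverse_comm)
  show "\<sigma> A = conj_transpose A"
    by (simp add: A simps conj_transpose_mult)
qed

text \<open>Differentiate \<open>\<sigma> A = A^*\<close> and \<open>A A^* = 1\<close> along a curve
  in the model.\<close>

lemma tangent_space_subset:
  assumes "v \<in> tangent_space (cartan_model \<sigma>) A"
  shows "\<sigma> v = conj_transpose v" "A ** conj_transpose v + v ** conj_transpose A = 0"
proof -
  obtain e \<gamma> where e: "e > 0" and M: "\<gamma> ` {-e<..<e} \<subseteq> cartan_model \<sigma>" and 0: "\<gamma> 0 = A"
    and v: "(\<gamma> has_vector_derivative v) (at 0)"
    using assms by (auto simp: tangent_space_def)
  have mem: "\<gamma> t \<in> cartan_model \<sigma>" if "t \<in> {-e<..<e}" for t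
    using M that by blast
  have star: "((\<lambda>t. conj_transpose (\<gamma> t)) has_vector_derivative conj_transpose v) (at 0)"
    using linear_conj_transpose v unfolding linear_conv_bounded_linear
    by (rule bounded_linear.has_vector_derivative)
  have "((\<lambda>t. \<sigma> (\<gamma> t)) has_vector_derivative \<sigma> v) (at 0)"
    using linear v unfolding linear_conv_bounded_linear
    by (rule bounded_linear.has_vector_derivative)
  then have "((\<lambda>t. conj_transpose (\<gamma> t)) has_vector_derivative \<sigma> v) (at 0)"
    by (rule has_vector_derivative_transform_within_open [where S = "{-e<..<e}"])
      (use e mem cartan_model_orthogonal in auto)
  then show "\<sigma> v = conj_transpose v"
    using star by (rule vector_derivative_unique_at)
  have "((\<lambda>t. \<gamma> t ** conj_transpose (\<gamma> t)) has_vector_derivative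
      \<gamma> 0 ** conj_transpose v + v ** conj_transpose (\<gamma> 0)) (at 0)"
    using v star by (rule matrix_mult.has_vector_derivative)
  then have "((\<lambda>t. mat 1 :: 'k^'n^'n) has_vector_derivative
      \<gamma> 0 ** conj_transpose v + v ** conj_transpose (\<gamma> 0)) (at 0)"
    by (rule has_vector_derivative_transform_within_open [where S = "{-e<..<e}"])
      (use e mem cartan_model_orthogonal in auto)
  then show "A ** conj_transpose v + v ** conj_transpose A = 0"
    using vector_derivative_unique_at [OF _ has_vector_derivative_const] 0 by blast
qed

lemma tangent_spaceI:
  assumes A: "A \<in> cartan_model \<sigma>"
    and v: "\<sigma> v = conj_transpose v" "A ** conj_transpose v + v ** conj_transpose A = 0"
  shows "v \<in> tangent_space (cartan_model \<sigma>) A"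
proof -
  obtain B where B: "B \<in> identity_component" and A_eq: "A = B ** conj_transpose (\<sigma> B)"
    using A by (auto simp: cartan_model_eq)
  \<comment> \<open>\<open>W\<close> is \<open>v\<close> transported from \<open>A\<close> to the
    identity, where the tangency conditions become linear in \<open>W\<close> alone.\<close>
  define W where "W = conj_transpose B ** v ** \<sigma> B"
  have v_eq: "v = B ** W ** conj_transpose (\<sigma> B)"
  proof -
    have "B ** W ** conj_transpose (\<sigma> B) =
        (B ** conj_transpose B) ** v ** (\<sigma> B ** conj_transpose (\<sigma> B))"
      by (simp only: W_def matrix_mul_assoc)
    then show ?thesis
      by (simp add: identity_component_orthogonal [OF B] orthogonal_image [OF B])
  qed
  have \<sigma>W: "\<sigma> W = conj_transpose W"
    by (simp add: W_def simps conj_transpose_mult v matrix_mul_assoc)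
  have "0 = conj_transpose B ** (A ** conj_transpose v + v ** conj_transpose A) ** B"
    by (simp add: v)
  also have "\<dots> = (conj_transpose B ** B) ** conj_transpose (\<sigma> B) ** conj_transpose v ** B
      + conj_transpose B ** v ** \<sigma> B ** (conj_transpose B ** B)"
    by (simp add: A_eq matrix_mult.add_left matrix_mult.add_right conj_transpose_mult
        matrix_mul_assoc)
  also have "\<dots> = conj_transpose W + W"
    by (simp add: identity_component_orthogonal [OF B])
      (simp add: W_def conj_transpose_mult matrix_mul_assoc)
  finally have skewW: "conj_transpose W = - W"
    by (simp add: eq_neg_iff_add_eq_0)
  \<comment> \<open>The Cayley transform has velocity \<open>2Y\<close> at 0 and its square has
    velocity \<open>4Y\<close>, which should be \<open>W\<close>.\<close>
  define Y where "Y = (1 / 4) *\<^sub>R W"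
  interpret skew_matrix Y
    by standard (simp add: Y_def conj_transpose_simps skewW)
  \<comment> \<open>Both sides are right inverses of \<open>1 + tY\<close>, since \<sigma> and the
    conjugate transpose each send \<open>Y\<close> to \<open>-Y\<close>.\<close>
  have \<sigma>R: "\<sigma> (resolvent t) = conj_transpose (resolvent t)" for t
  proof -
    have "(mat 1 + t *\<^sub>R Y) ** \<sigma> (resolvent t) = mat 1"
      using arg_cong [OF resolvent_inverse(1) [of t], of \<sigma>] by (simp add: simps Y_def \<sigma>W skewW)
    moreover have "(mat 1 + t *\<^sub>R Y) ** conj_transpose (resolvent t) = mat 1"
      using arg_cong [OF resolvent_inverse(2) [of t], of conj_transpose]
      by (simp add: conj_transpose_simps skew)
    ultimately show ?thesis
      using matrix_inv_eqI by metis
  qed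
  define \<gamma> where "\<gamma> t = B ** (cayley t ** cayley t) ** conj_transpose (\<sigma> B)" for t
  have "\<gamma> t \<in> cartan_model \<sigma>" for t
  proof -
    have "conj_transpose (\<sigma> (cayley t)) = cayley t"
      by (simp add: cayley_def simps conj_transpose_simps \<sigma>R)
    then have "\<gamma> t = (B ** cayley t) ** conj_transpose (\<sigma> (B ** cayley t))"
      by (simp add: \<gamma>_def simps conj_transpose_mult matrix_mul_assoc)
    then show ?thesis
      using cayley_in_identity_component [OF B] by (auto simp: cartan_model_eq)
  qed
  moreover have "\<gamma> 0 = A"
    by (simp add: \<gamma>_def A_eq)
  moreover have "(\<gamma> has_vector_derivative v) (at 0)"
  proof -
    have deriv: "(cayley has_vector_derivative 2 *\<^sub>R Y) (at 0)"
      using cayley_derivative [of 0] by simp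
    have "cayley 0 ** (2 *\<^sub>R Y) + 2 *\<^sub>R Y ** cayley 0 = W"
      by (simp flip: scaleR_left_distrib) (simp add: Y_def)
    then have "((\<lambda>t. cayley t ** cayley t) has_vector_derivative W) (at 0)"
      using matrix_mult.has_vector_derivative [OF deriv deriv] by simp
    then show ?thesis
      unfolding \<gamma>_def v_eq
      by (intro bounded_linear.has_vector_derivative [OF matrix_mult.bounded_linear_left]
          bounded_linear.has_vector_derivative [OF matrix_mult.bounded_linear_right])
  qed
  moreover have "smooth_curve_on {-1<..<1} \<gamma>"
    using smooth_curve_on_cayley unfolding \<gamma>_def .
  ultimately show ?thesis
    unfolding tangent_space_def by (auto intro!: exI [of _ 1] exI [of _ \<gamma>])
qed

end

section \<open>Critical points\<close>

text \<open>A derivative within \<open>M\<close> may be non-unique, but the chain rule along a curve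
  in \<open>M\<close> forces it to agree with \<open>f\<close> on tangent vectors. Conversely,
  \<open>f\<close> is its own derivative.\<close>

lemma critical_point_on_linear_iff:
  fixes f :: "'a::euclidean_space \<Rightarrow> real"
  assumes "linear f" "A \<in> M"
  shows "critical_point_on M f A \<longleftrightarrow> (\<forall>v\<in>tangent_space M A. f v = 0)"
proof
  have bl: "bounded_linear f"
    using assms by (simp add: linear_conv_bounded_linear)
  show "critical_point_on M f A" if "\<forall>v\<in>tangent_space M A. f v = 0"
    unfolding critical_point_on_def
    using that assms bounded_linear_imp_has_derivative [OF bl] by blast
  assume "critical_point_on M f A"
  then obtain f' where f': "(f has_derivative f') (at A within M)"
    and zero: "\<And>v. v \<in> tangent_space M A \<Longrightarrow> f' v = 0"
    by (auto simp: critical_point_on_def)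
  show "\<forall>v\<in>tangent_space M A. f v = 0"
  proof
    fix v
    assume v_tangent: "v \<in> tangent_space M A"
    then obtain e \<gamma> where e: "e > 0" and M: "\<gamma> ` {-e<..<e} \<subseteq> M" and 0: "\<gamma> 0 = A"
      and v: "(\<gamma> has_vector_derivative v) (at 0)"
      by (auto simp: tangent_space_def)
    have "(f has_derivative f') (at (\<gamma> 0) within \<gamma> ` {-e<..<e})"
      using f' M 0 by (auto intro: has_derivative_subset)
    moreover have "(\<gamma> has_derivative (\<lambda>x. x *\<^sub>R v)) (at 0 within {-e<..<e})"
      using v unfolding has_vector_derivative_def by (rule has_derivative_at_withinI)
    ultimately have "(f \<circ> \<gamma> has_derivative f' \<circ> (\<lambda>x. x *\<^sub>R v)) (at 0 within {-e<..<e})"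
      by (intro diff_chain_within)
    then have "(f \<circ> \<gamma> has_derivative f' \<circ> (\<lambda>x. x *\<^sub>R v)) (at 0)"
      using e by (simp add: at_within_open [of 0 "{-e<..<e}"])
    moreover have "(f \<circ> \<gamma> has_derivative (\<lambda>x. x *\<^sub>R f v)) (at 0)"
      using bounded_linear.has_vector_derivative [OF bl v]
      by (simp add: has_vector_derivative_def comp_def)
    ultimately have "f' \<circ> (\<lambda>x. x *\<^sub>R v) = (\<lambda>x. x *\<^sub>R f v)"
      by (rule has_derivative_unique)
    then have "f' v = f v"
      by (metis comp_apply scaleR_one)
    then show "f v = 0"
      using zero [OF v_tangent] by simp
  qed
qed

context star_involutive
begin

theorem critical_point_on_cartan_model_iff:
  assumes A: "A \<in> cartan_model \<sigma>"
  shows "critical_point_on (cartan_model \<sigma>) (height X) A \<longleftrightarrow> hat \<sigma> X = A ** \<sigma> (hat \<sigma> X) ** A"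
proof -
  note A_simps = cartan_model_orthogonal [OF A]
  let ?H = "hat \<sigma> X" and ?T = "tangent_space (cartan_model \<sigma>) A"
  let ?Z = "?H - A ** \<sigma> ?H ** A"
  have \<sigma>H: "\<sigma> ?H = conj_transpose ?H"
    by (simp add: hat_def simps conj_transpose_simps add.commute)
  have "linear (height X)"
    by (rule linearI) (simp_all add: height_eq_inner inner_add_right)
  then have crit: "critical_point_on (cartan_model \<sigma>) (height X) A \<longleftrightarrow> (\<forall>v\<in>?T. height X v = 0)"
    using A by (rule critical_point_on_linear_iff)
  have Z_tangent: "?Z \<in> ?T"
  proof (rule tangent_spaceI [OF A])
    show "\<sigma> ?Z = conj_transpose ?Z"
      by (simp add: simps conj_transpose_simps \<sigma>H A_simps matrix_mul_assoc)
    have "A ** conj_transpose ?Z + ?Z ** conj_transpose A =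
        A ** conj_transpose ?H - (A ** conj_transpose A) ** ?H ** conj_transpose A +
        (?H ** conj_transpose A - A ** conj_transpose ?H ** (A ** conj_transpose A))"
      by (simp only: \<sigma>H conj_transpose_simps matrix_mult.diff_left matrix_mult.diff_right
          conj_transpose_conj_transpose matrix_mul_assoc)
    then show "A ** conj_transpose ?Z + ?Z ** conj_transpose A = 0"
      by (simp add: A_simps)
  qed
  have Z_inner: "inner ?Z v = 4 * height X v" if "v \<in> ?T" for v
  proof -
    note v = tangent_space_subset [OF that]
    have "conj_transpose A ** v ** conj_transpose A = - conj_transpose v"
    proof -
      have "conj_transpose A ** (A ** conj_transpose v + v ** conj_transpose A) = 0"
        by (simp add: v)
      then have "(conj_transpose A ** A) ** conj_transpose v +
          conj_transpose A ** v ** conj_transpose A = 0"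
        by (simp only: matrix_mult.add_right matrix_mul_assoc)
      then show ?thesis
        by (simp add: A_simps eq_neg_iff_add_eq_0 add.commute)
    qed
    \<comment> \<open>Moving both factors \<open>A\<close> across the inner product turns
      \<open>v\<close> into \<open>A^* v A^*\<close>, which is \<open>-v^*\<close> by
      tangency.\<close>
    then have "inner (A ** \<sigma> ?H ** A) v = - inner (conj_transpose ?H) (conj_transpose v)"
      using inner_mult_right [of "A ** \<sigma> ?H" A v]
        inner_mult_left [of A "\<sigma> ?H" "v ** conj_transpose A"]
      by (simp add: matrix_mul_assoc \<sigma>H)
    then have "inner ?Z v = 2 * inner ?H v"
      by (simp add: inner_diff_left inner_conj_transpose)
    \<comment> \<open>Both sides equal the inner product of \<open>X\<close> and \<open>v^*\<close>,
      as \<sigma> and the conjugate transpose are isometries and both send \<open>v^*\<close> to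
      \<open>v\<close>.\<close>
    moreover have "inner (\<sigma> X) v = inner (conj_transpose X) v"
      using inner [of X "conj_transpose v"] inner_conj_transpose [of X "conj_transpose v"]
      by (simp add: simps v)
    ultimately show ?thesis
      by (simp add: hat_def inner_add_left height_eq_inner)
  qed
  show ?thesis
  proof
    assume "critical_point_on (cartan_model \<sigma>) (height X) A"
    \<comment> \<open>The vanishing differential is tested on the tangent vector \<open>?Z\<close>
      itself.\<close>
    then have "inner ?Z ?Z = 0"
      using crit Z_tangent Z_inner by simp
    then show "?H = A ** \<sigma> ?H ** A"
      by simp
  next
    assume "?H = A ** \<sigma> ?H ** A"
    then have "?Z = 0"
      by simp
    then have "\<forall>v\<in>?T. height X v = 0"
      using Z_inner by (metis inner_zero_left mult_eq_0_iff zero_neq_numeral)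
    then show "critical_point_on (cartan_model \<sigma>) (height X) A"
      using crit by simp
  qed
qed

end

theorem corollary2p3:
  shows
    "(\<forall>(\<sigma> :: real^'n^'n \<Rightarrow> real^'n^'n) X A.
        star_involution \<sigma> \<longrightarrow> X \<noteq> 0 \<longrightarrow> A \<in> cartan_model \<sigma> \<longrightarrow>
        (critical_point_on (cartan_model \<sigma>) (height X) A \<longleftrightarrow> hat \<sigma> X = A ** \<sigma> (hat \<sigma> X) ** A))
     \<and>
     (\<forall>(\<sigma> :: complex^'n^'n \<Rightarrow> complex^'n^'n) X A.
        star_involution \<sigma> \<longrightarrow> X \<noteq> 0 \<longrightarrow> A \<in> cartan_model \<sigma> \<longrightarrow>
        (critical_point_on (cartan_model \<sigma>) (height X) A \<longleftrightarrow> hat \<sigma> X = A ** \<sigma> (hat \<sigma> X) ** A))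
     \<and>
     (\<forall>(\<sigma> :: quat^'n^'n \<Rightarrow> quat^'n^'n) X A.
        star_involution \<sigma> \<longrightarrow> X \<noteq> 0 \<longrightarrow> A \<in> cartan_model \<sigma> \<longrightarrow>
        (critical_point_on (cartan_model \<sigma>) (height X) A \<longleftrightarrow> hat \<sigma> X = A ** \<sigma> (hat \<sigma> X) ** A))"
  by (simp add: star_involutive.critical_point_on_cartan_model_iff [OF star_involutive.intro])

end
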